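(* Let $n\ge 2$ and $k\in\{1,\dots,n-1\}$. Consider the Hopfield network $$\dot x_i(t)=-\frac{x_i(t)}{r_i}+\sum_{j=1}^n w_{ij}\phi_j(x_j(t))+u_i,\qquad i=1,\dots,n,$$ where $r_i>0$, $u_i\in\mathbb{R}$ and $w_{ij}\in\mathbb{R}$ are constants, and each $\phi_i:\mathbb{R}\to\mathbb{R}$ is $C^1$. Assume that there are constants $m_i,M_i$ such that $$0\le m_i\le|\phi_i'(z)|\le M_i\quad\text{for all } z\in\mathbb{R}\text{ and } i\in\{1,\dots,n\}.$$ If there exist $d_1,\dots,d_n>0$ and $\eta>0$ such that, for all $i\in\{1,\dots,n\}$, $$-(n-k-1)\left(-r_i^{-1}-m_i|w_{ii}|\right)+\sum_{j\ne i}\Big(-r_j^{-1}+M_j|w_{jj}|+(n-k)\frac{d_j}{d_i}M_i|w_{ji}|\Big)\le-\eta<0,$$ then the network is $k$-contractive with rate $\eta$ with respect to the scaled $L_\infty$ norm with $D:=\operatorname{diag}(d_1,\dots,d_n)$, that is, $$\mu_{\infty,D^{(k)}}\big(J^{[k]}(x)\big)\le-\eta\quad\text{for all } x\in\mathbb{R}^n,$$ where $J(x)=-\operatorname{diag}(r_1^{-1},\dots,r_n^{-1})+W\operatorname{diag}(\phi_1'(x_1),\dots,\phi_n'(x_n))$, with $W=\{w_{ij}\}_{i,j=1}^n$, is the Jacobian of the vector field.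
   Context: The $k$-multiplicative compound $B^{(k)}$ of an $n\times n$ matrix $B$ is the $\binom{n}{k}\times\binom{n}{k}$ matrix of all $k$-minors of $B$, with rows and columns indexed by the increasing sequences of $k$ integers from $\{1,\dots,n\}$ in lexicographic order. The $k$-additive compound is $B^{[k]}:=\frac{d}{d\varepsilon}(I_n+\varepsilon B)^{(k)}\big|_{\varepsilon=0}$; $J^{[k]}(x)$ means $(J(x))^{[k]}$. A norm on $\mathbb{R}^m$ with induced matrix norm $\|\cdot\|$ induces the log norm $\mu(B):=\lim_{\varepsilon\downarrow0}\frac{\|I+\varepsilon B\|-1}{\varepsilon}$. $\mu_\infty$ is the log norm induced by the $L_\infty$ norm, and for an invertible matrix $H$, $\mu_{\infty,H}(B):=\mu_\infty(HBH^{-1})$. $k$-contraction with rate $\eta$ with respect to the $L_\infty$ norm scaled by $D$ is understood in the sense of the infinitesimal condition: the log norm, with weight matrix $D^{(k)}$, of the $k$-additive compound of the Jacobian is at most $-\eta<0$ everywhere. *)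

theory Defs
  imports
    "HOL-Analysis.Derivative"
    "HOL-Library.List_Lexorder"
    "Jordan_Normal_Form.Determinant"
    "Jordan_Normal_Form.Gauss_Jordan_Elimination"
begin

text \<open>
  Vectors and matrices are those of Jordan_Normal_Form, since the compounds of an
  \<open>n \<times> n\<close> matrix have dimension \<open>n choose k\<close>. All indices start at \<open>0\<close>.
\<close>

section \<open>Compound matrices\<close>

text \<open>Order on \<^typ>\<open>nat list\<close> is the lexicographic one from \<^theory>\<open>HOL-Library.List_Lexorder\<close>.\<close>

definition incr_seqs :: "nat \<Rightarrow> nat \<Rightarrow> nat list list" where
  "incr_seqs n k =
     sorted_list_of_set {\<alpha>. length \<alpha> = k \<and> sorted_wrt (<) \<alpha> \<and> set \<alpha> \<subseteq> {..<n}}"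

lemma finite_incr_seqs:
  "finite {\<alpha>. length \<alpha> = k \<and> sorted_wrt (<) \<alpha> \<and> set \<alpha> \<subseteq> {..<n::nat}}"
  by (rule finite_subset[OF _ finite_lists_length_eq[of "{..<n}" k]]) auto

lemma length_incr_seqs: "length (incr_seqs n k) = n choose k"
proof -
  let ?A = "{\<alpha>. length \<alpha> = k \<and> sorted_wrt (<) \<alpha> \<and> set \<alpha> \<subseteq> {..<n::nat}}"
  let ?B = "{S. S \<subseteq> {..<n} \<and> card S = k}"
  have "bij_betw set ?A ?B"
  proof (rule bij_betwI[where g = sorted_list_of_set])
    show "set \<in> ?A \<rightarrow> ?B"
      by (auto simp: strict_sorted_iff distinct_card)
    show "sorted_list_of_set \<in> ?B \<rightarrow> ?A"
    proof
      fix S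
      assume S: "S \<in> ?B"
      then have "finite S"
        by (auto intro: finite_subset[OF _ finite_lessThan])
      then show "sorted_list_of_set S \<in> ?A"
        using S by simp
    qed
    show "sorted_list_of_set (set \<alpha>) = \<alpha>" if "\<alpha> \<in> ?A" for \<alpha>
      using that by (auto simp: strict_sorted_iff sorted_list_of_set.idem_if_sorted_distinct)
    show "set (sorted_list_of_set S) = S" if "S \<in> ?B" for S
      using that finite_subset[OF _ finite_lessThan, of S n] by simp
  qed
  then have "card ?A = card ?B"
    by (rule bij_betw_same_card)
  also have "\<dots> = n choose k"
    using n_subsets[of "{..<n}" k] by simp
  finally show ?thesis
    by (simp add: incr_seqs_def)
qed

definition mult_compound :: "nat \<Rightarrow> real mat \<Rightarrow> real mat" where
  "mult_compound k B =
     (let n = dim_row B; N = n choose k; s = incr_seqs n k in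
        mat N N (\<lambda>(p, q). det (mat k k (\<lambda>(a, b). B $$ (s ! p ! a, s ! q ! b)))))"

text \<open>The derivative of a matrix-valued function is the entrywise one.\<close>

definition add_compound :: "nat \<Rightarrow> real mat \<Rightarrow> real mat" where
  "add_compound k B =
     (let n = dim_row B; N = n choose k in
        mat N N (\<lambda>(p, q).
          deriv (\<lambda>\<epsilon>. mult_compound k (1\<^sub>m n + \<epsilon> \<cdot>\<^sub>m B) $$ (p, q)) 0))"

section \<open>Logarithmic norms\<close>

definition Linf_norm :: "real vec \<Rightarrow> real" where
  "Linf_norm v = Max ((\<lambda>i. \<bar>v $ i\<bar>) ` {..<dim_vec v})"

definition induced_norm :: "(real vec \<Rightarrow> real) \<Rightarrow> real mat \<Rightarrow> real" where
  "induced_norm nrm A =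
     (SUP v \<in> {v \<in> carrier_vec (dim_col A). nrm v = 1}. nrm (A *\<^sub>v v))"

definition log_norm :: "(real vec \<Rightarrow> real) \<Rightarrow> real mat \<Rightarrow> real" where
  "log_norm nrm B =
     Lim (at_right 0) (\<lambda>\<epsilon>. (induced_norm nrm (1\<^sub>m (dim_row B) + \<epsilon> \<cdot>\<^sub>m B) - 1) / \<epsilon>)"

text \<open>Meaningful for invertible \<open>H\<close>, where \<^const>\<open>mat_inverse\<close> yields \<^const>\<open>Some\<close> inverse.\<close>

definition log_norm_Linf_scaled :: "real mat \<Rightarrow> real mat \<Rightarrow> real" where
  "log_norm_Linf_scaled H B = log_norm Linf_norm (H * B * the (mat_inverse H))"

section \<open>Contraction of order k\<close>

text \<open>\<open>A\<close> is the matrix of partial derivatives of \<open>f : \<real>\<^sup>n \<rightarrow> \<real>\<^sup>n\<close> at \<open>x\<close>, all of which exist.\<close>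

definition has_jacobian :: "nat \<Rightarrow> (real vec \<Rightarrow> real vec) \<Rightarrow> real vec \<Rightarrow> real mat \<Rightarrow> bool" where
  "has_jacobian n f x A \<longleftrightarrow>
     A \<in> carrier_mat n n \<and>
     (\<forall>i<n. \<forall>j<n.
        ((\<lambda>t. f (x + t \<cdot>\<^sub>v unit_vec n j) $ i) has_real_derivative A $$ (i, j)) (at 0))"

text \<open>
  Infinitesimal \<open>k\<close>-contraction of \<open>x' = f x\<close> on \<open>\<real>\<^sup>n\<close> with rate \<open>\<eta>\<close>, with respect to the
  \<open>L\<^sub>\<infinity>\<close> norm scaled by \<open>D\<close>.
\<close>

definition k_contractive_Linf ::
  "nat \<Rightarrow> nat \<Rightarrow> real mat \<Rightarrow> real \<Rightarrow> (real vec \<Rightarrow> real vec) \<Rightarrow> bool" where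
  "k_contractive_Linf n k D \<eta> f \<longleftrightarrow>
     0 < \<eta> \<and>
     (\<forall>x \<in> carrier_vec n. \<exists>J. has_jacobian n f x J \<and>
        log_norm_Linf_scaled (mult_compound k D) (add_compound k J) \<le> - \<eta>)"

section \<open>Hopfield networks\<close>

definition hopfield_field ::
  "nat \<Rightarrow> (nat \<Rightarrow> real) \<Rightarrow> real mat \<Rightarrow> (nat \<Rightarrow> real \<Rightarrow> real) \<Rightarrow> (nat \<Rightarrow> real) \<Rightarrow> real vec \<Rightarrow> real vec" where
  "hopfield_field n r W \<phi> u x =
     vec n (\<lambda>i. - (x $ i) / r i + (\<Sum>j<n. W $$ (i, j) * \<phi> j (x $ j)) + u i)"

definition hopfield_jacobian ::
  "nat \<Rightarrow> (nat \<Rightarrow> real) \<Rightarrow> real mat \<Rightarrow> (nat \<Rightarrow> real \<Rightarrow> real) \<Rightarrow> real vec \<Rightarrow> real mat" where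
  "hopfield_jacobian n r W \<phi> x =
     - mat_diag n (\<lambda>i. inverse (r i)) + W * mat_diag n (\<lambda>i. deriv (\<phi> i) (x $ i))"

end

theory Submission
  imports Defs
begin

text \<open>
  The log norm induced by the maximum norm is the largest of the row quantities
  \<open>c\<^sub>i\<^sub>i + \<Sum>j\<noteq>i. \<bar>c\<^sub>i\<^sub>j\<bar>\<close>. Scaling by \<open>D\<close> commutes with taking the additive compound, and the rows of
  \<open>A\<^bsup>[k]\<^esup>\<close> are indexed by the \<open>k\<close>-subsets \<open>S\<close>: the diagonal entry is \<open>\<Sum>i\<in>S. a\<^sub>i\<^sub>i\<close>, and the nonzero
  off-diagonal entries are \<open>\<plusminus>a\<^sub>i\<^sub>j\<close> with \<open>i \<in> S\<close> and \<open>j \<notin> S\<close>. Hence a bound for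
  \<open>\<Sum>i\<in>S. (a\<^sub>i\<^sub>i + \<Sum>j\<notin>S. (d\<^sub>i / d\<^sub>j) \<bar>a\<^sub>i\<^sub>j\<bar>)\<close> is needed for every \<open>S\<close>, and the average of the hypothesis over
  the \<open>n - k\<close> indices \<open>i \<notin> S\<close> gives it.
\<close>

section \<open>The log norm induced by the maximum norm\<close>

lemma Linf_norm_le:
  assumes "0 < dim_vec v" and "\<And>i. i < dim_vec v \<Longrightarrow> \<bar>v $ i\<bar> \<le> c"
  shows "Linf_norm v \<le> c"
  unfolding Linf_norm_def using assms by (subst Max_le_iff) auto

lemma abs_le_Linf_norm:
  assumes "i < dim_vec v"
  shows "\<bar>v $ i\<bar> \<le> Linf_norm v"
  unfolding Linf_norm_def using assms by (intro Max_ge) auto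

lemma index_mult_mat_vec_sum:
  assumes "A \<in> carrier_mat m n" and "v \<in> carrier_vec n" and "i < m"
  shows "(A *\<^sub>v v) $ i = (\<Sum>j<n. A $$ (i, j) * v $ j)"
  using assms by (auto simp: scalar_prod_def atLeast0LessThan intro!: sum.cong)

text \<open>The triangle inequality in each row gives the upper bound. It is attained at the sign
  vector of a row with the largest absolute sum, so the supremum is a maximum.\<close>

lemma induced_norm_Linf:
  assumes A: "A \<in> carrier_mat m n" and m: "0 < m" and n: "0 < n"
  shows "induced_norm Linf_norm A = Max ((\<lambda>i. \<Sum>j<n. \<bar>A $$ (i, j)\<bar>) ` {..<m})"
    (is "_ = Max (?R ` _)")
  unfolding induced_norm_def
proof (rule cSup_eq_maximum)
  have ub: "Linf_norm (A *\<^sub>v v) \<le> Max (?R ` {..<m})"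
    if v: "v \<in> carrier_vec n" "Linf_norm v = 1" for v
  proof (rule Linf_norm_le)
    show "0 < dim_vec (A *\<^sub>v v)"
      using A m by simp
    fix i assume "i < dim_vec (A *\<^sub>v v)"
    then have i: "i < m"
      using A by simp
    have "\<bar>(A *\<^sub>v v) $ i\<bar> \<le> (\<Sum>j<n. \<bar>A $$ (i, j)\<bar> * \<bar>v $ j\<bar>)"
      unfolding index_mult_mat_vec_sum[OF A v(1) i] abs_mult[symmetric] by (rule sum_abs)
    also have "\<dots> \<le> ?R i"
      using abs_le_Linf_norm[of _ v] v by (intro sum_mono mult_left_le) auto
    also have "\<dots> \<le> Max (?R ` {..<m})"
      using i by (intro Max_ge) auto
    finally show "\<bar>(A *\<^sub>v v) $ i\<bar> \<le> Max (?R ` {..<m})" .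
  qed
  then show "y \<le> Max (?R ` {..<m})"
    if "y \<in> (\<lambda>v. Linf_norm (A *\<^sub>v v)) ` {v \<in> carrier_vec (dim_col A). Linf_norm v = 1}" for y
    using that A by auto
  have "Max (?R ` {..<m}) \<in> ?R ` {..<m}"
    using m by (intro Max_in) auto
  then obtain i where i: "i < m" "Max (?R ` {..<m}) = ?R i"
    by auto
  \<comment> \<open>Zero entries get sign 1, so that \<open>v\<close> has norm 1 even when the whole
    row vanishes.\<close>
  define v where "v = vec n (\<lambda>j. if A $$ (i, j) < 0 then - 1 else 1 :: real)"
  have v: "v \<in> carrier_vec n"
    by (simp add: v_def)
  have "Linf_norm v \<le> 1"
    using n by (intro Linf_norm_le) (auto simp: v_def)
  moreover have "1 \<le> Linf_norm v"
    using abs_le_Linf_norm[of 0 v] n by (auto simp: v_def split: if_splits)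
  ultimately have v1: "Linf_norm v = 1"
    by simp
  have "(A *\<^sub>v v) $ i = ?R i"
    unfolding index_mult_mat_vec_sum[OF A v i(1)] by (intro sum.cong) (auto simp: v_def)
  then have "?R i \<le> Linf_norm (A *\<^sub>v v)"
    using abs_le_Linf_norm[of i "A *\<^sub>v v"] i(1) A by simp
  then have "Linf_norm (A *\<^sub>v v) = Max (?R ` {..<m})"
    using ub[OF v v1] i(2) by simp
  then show "Max (?R ` {..<m})
    \<in> (\<lambda>v. Linf_norm (A *\<^sub>v v)) ` {v \<in> carrier_vec (dim_col A). Linf_norm v = 1}"
    using v v1 A by (intro image_eqI[of _ _ v]) auto
qed

text \<open>
  For small \<open>\<epsilon>\<close> all diagonal entries of \<open>I + \<epsilon> C\<close> are positive, so that the difference quotient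
  in the definition of the log norm is eventually constant.
\<close>

lemma log_norm_Linf:
  assumes C: "C \<in> carrier_mat n n" and n: "0 < n"
  shows "log_norm Linf_norm C =
    Max ((\<lambda>i. C $$ (i, i) + (\<Sum>j \<in> {..<n} - {i}. \<bar>C $$ (i, j)\<bar>)) ` {..<n})"
    (is "_ = Max (?R ` _)")
proof -
  have "\<forall>\<^sub>F \<epsilon> in at_right 0. 0 < 1 + \<epsilon> * C $$ (i, i)" for i
  proof -
    have "((\<lambda>\<epsilon>. 1 + \<epsilon> * C $$ (i, i)) \<longlongrightarrow> 1 + 0 * C $$ (i, i)) (at_right 0)"
      by (intro tendsto_intros)
    then show ?thesis
      by (rule order_tendstoD) simp
  qed
  then have "\<forall>\<^sub>F \<epsilon> in at_right 0. \<forall>i\<in>{..<n}. 0 < 1 + \<epsilon> * C $$ (i, i)"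
    by (intro eventually_ball_finite) auto
  moreover have "\<forall>\<^sub>F \<epsilon> in at_right 0. (0 :: real) < \<epsilon>"
    by (rule eventually_at_right_less)
  ultimately have "\<forall>\<^sub>F \<epsilon> in at_right 0.
    (induced_norm Linf_norm (1\<^sub>m (dim_row C) + \<epsilon> \<cdot>\<^sub>m C) - 1) / \<epsilon> = Max (?R ` {..<n})"
  proof eventually_elim
    case (elim \<epsilon>)
    let ?A = "1\<^sub>m (dim_row C) + \<epsilon> \<cdot>\<^sub>m C"
    have row: "(\<Sum>j<n. \<bar>?A $$ (i, j)\<bar>) = 1 + \<epsilon> * ?R i" if i: "i < n" for i
    proof -
      have "(\<Sum>j<n. \<bar>?A $$ (i, j)\<bar>) = \<bar>?A $$ (i, i)\<bar> + (\<Sum>j\<in>{..<n} - {i}. \<bar>?A $$ (i, j)\<bar>)"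
        using i by (intro sum.remove) auto
      also have "\<bar>?A $$ (i, i)\<bar> = 1 + \<epsilon> * C $$ (i, i)"
        using elim i C by (auto simp: less_imp_le)
      also have "(\<Sum>j\<in>{..<n} - {i}. \<bar>?A $$ (i, j)\<bar>) = \<epsilon> * (\<Sum>j\<in>{..<n} - {i}. \<bar>C $$ (i, j)\<bar>)"
        unfolding sum_distrib_left using elim i C by (intro sum.cong) (auto simp: abs_mult)
      finally show ?thesis
        by (simp add: algebra_simps)
    qed
    have "induced_norm Linf_norm ?A = Max ((\<lambda>i. \<Sum>j<n. \<bar>?A $$ (i, j)\<bar>) ` {..<n})"
      using C n by (intro induced_norm_Linf) auto
    also have "(\<lambda>i. \<Sum>j<n. \<bar>?A $$ (i, j)\<bar>) ` {..<n} = (\<lambda>x. 1 + \<epsilon> * x) ` ?R ` {..<n}"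
      unfolding image_image using row by (intro image_cong) auto
    \<comment> \<open>The affine map is monotone because \<epsilon> is positive, hence it commutes
      with the maximum.\<close>
    also have "Max \<dots> = 1 + \<epsilon> * Max (?R ` {..<n})"
      using elim n by (intro mono_Max_commute[symmetric]) (auto intro!: monoI mult_left_mono)
    finally show ?case
      using elim by simp
  qed
  then show ?thesis
    unfolding log_norm_def by (intro tendsto_Lim tendsto_eventually) auto
qed

section \<open>Compounds\<close>

lemma set_incr_seqs:
  "set (incr_seqs n k) = {\<alpha>. length \<alpha> = k \<and> sorted_wrt (<) \<alpha> \<and> set \<alpha> \<subseteq> {..<n}}"
  unfolding incr_seqs_def using finite_incr_seqs by simp

lemma distinct_incr_seqs: "distinct (incr_seqs n k)"
  unfolding incr_seqs_def by simp

lemma incr_seqsD: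
  assumes "\<alpha> \<in> set (incr_seqs n k)"
  shows "length \<alpha> = k" "sorted_wrt (<) \<alpha>" "distinct \<alpha>" "set \<alpha> \<subseteq> {..<n}"
  using assms by (auto simp: set_incr_seqs strict_sorted_iff)

lemma incr_seqs_nth_less:
  assumes "\<alpha> \<in> set (incr_seqs n k)" and "a < k"
  shows "\<alpha> ! a < n"
  using assms nth_mem[of a \<alpha>] by (fastforce simp: set_incr_seqs simp del: nth_mem)

lemma incr_seqs_eqI:
  assumes "\<alpha> \<in> set (incr_seqs n k)" and "\<beta> \<in> set (incr_seqs n k)" and "set \<alpha> = set \<beta>"
  shows "\<alpha> = \<beta>"
  using assms incr_seqsD(2) by (blast intro: strict_sorted_equal)

lemma set_eq_image_permutes:
  assumes "length \<beta> = k" and "p permutes {0..<k}"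
  shows "set \<beta> = (\<lambda>b. \<beta> ! p b) ` {0..<k}"
proof -
  have "set \<beta> = (\<lambda>b. \<beta> ! b) ` p ` {0..<k}"
    using assms by (auto simp: permutes_image set_conv_nth)
  then show ?thesis
    by (simp add: image_image)
qed

text \<open>A strictly increasing sequence is determined by its set of entries, which a permutation
  of positions preserves. So in a Leibniz expansion two distinct index sequences never match at all
  positions.\<close>

lemma incr_seqs_eq_if_permuted:
  assumes \<alpha>: "\<alpha> \<in> set (incr_seqs n k)" and \<beta>: "\<beta> \<in> set (incr_seqs n k)"
    and p: "p permutes {0..<k}" and "\<And>b. b < k \<Longrightarrow> \<alpha> ! b = \<beta> ! p b"
  shows "\<alpha> = \<beta>"
proof (rule incr_seqs_eqI[OF \<alpha> \<beta>])
  have "set \<alpha> = (\<lambda>b. \<alpha> ! b) ` {0..<k}"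
    using incr_seqsD(1)[OF \<alpha>] by (auto simp: set_conv_nth)
  also have "\<dots> = (\<lambda>b. \<beta> ! p b) ` {0..<k}"
    using assms(4) by auto
  finally show "set \<alpha> = set \<beta>"
    using set_eq_image_permutes[OF incr_seqsD(1)[OF \<beta>] p] by simp
qed

text \<open>The derivative at \<open>0\<close> of the Leibniz formula for the minor \<open>(\<alpha>|\<beta>)\<close> of \<open>I + \<epsilon> F\<close>.\<close>

definition minor_deriv :: "(nat \<Rightarrow> nat \<Rightarrow> real) \<Rightarrow> nat list \<Rightarrow> nat list \<Rightarrow> real" where
  "minor_deriv F \<alpha> \<beta> =
     (\<Sum>p | p permutes {0..<length \<alpha>}. of_int (sign p) *
        (\<Sum>a\<in>{0..<length \<alpha>}. F (\<alpha> ! a) (\<beta> ! p a) *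
          (\<Prod>b\<in>{0..<length \<alpha>} - {a}. of_bool (\<alpha> ! b = \<beta> ! p b))))"

section \<open>Entries of the additive compound\<close>

lemma add_compound_carrier:
  assumes "A \<in> carrier_mat n n"
  shows "add_compound k A \<in> carrier_mat (n choose k) (n choose k)"
  using assms by (simp add: add_compound_def Let_def)

text \<open>By the Leibniz formula a minor of I + \<epsilon> A is a polynomial in \<epsilon>. The
  product rule at 0 differentiates one factor, which yields an entry of A, and leaves entries of the
  identity in the others.\<close>

lemma add_compound_index:
  assumes A: "A \<in> carrier_mat n n" and pq: "p < n choose k" "q < n choose k"
  shows "add_compound k A $$ (p, q) =
    minor_deriv (\<lambda>i j. A $$ (i, j)) (incr_seqs n k ! p) (incr_seqs n k ! q)"
proof -
  define \<alpha> \<beta> where "\<alpha> = incr_seqs n k ! p" and "\<beta> = incr_seqs n k ! q"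
  have \<alpha>: "\<alpha> \<in> set (incr_seqs n k)" and \<beta>: "\<beta> \<in> set (incr_seqs n k)"
    using pq by (auto simp: \<alpha>_def \<beta>_def length_incr_seqs)
  have k: "length \<alpha> = k"
    using incr_seqsD(1)[OF \<alpha>] .
  have eq: "mult_compound k (1\<^sub>m n + \<epsilon> \<cdot>\<^sub>m A) $$ (p, q) =
    (\<Sum>\<pi> | \<pi> permutes {0..<k}. of_int (sign \<pi>) *
      (\<Prod>a\<in>{0..<k}. of_bool (\<alpha> ! a = \<beta> ! \<pi> a) + \<epsilon> * A $$ (\<alpha> ! a, \<beta> ! \<pi> a)))" for \<epsilon>
  proof -
    have "mult_compound k (1\<^sub>m n + \<epsilon> \<cdot>\<^sub>m A) $$ (p, q) =
      det (mat k k (\<lambda>(a, b). (1\<^sub>m n + \<epsilon> \<cdot>\<^sub>m A) $$ (\<alpha> ! a, \<beta> ! b)))"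
      using A pq by (simp add: mult_compound_def Let_def \<alpha>_def \<beta>_def)
    also have "\<dots> = (\<Sum>\<pi> | \<pi> permutes {0..<k}. of_int (sign \<pi>) *
      (\<Prod>a\<in>{0..<k}. of_bool (\<alpha> ! a = \<beta> ! \<pi> a) + \<epsilon> * A $$ (\<alpha> ! a, \<beta> ! \<pi> a)))"
      using A by (subst det_def'[of _ k])
        (auto intro!: sum.cong prod.cong
          simp: incr_seqs_nth_less[OF \<alpha>] incr_seqs_nth_less[OF \<beta>] permutes_nat_less)
    finally show ?thesis .
  qed
  have "((\<lambda>\<epsilon>. \<Sum>\<pi> | \<pi> permutes {0..<k}. of_int (sign \<pi>) *
      (\<Prod>a\<in>{0..<k}. of_bool (\<alpha> ! a = \<beta> ! \<pi> a) + \<epsilon> * A $$ (\<alpha> ! a, \<beta> ! \<pi> a)))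
    has_real_derivative minor_deriv (\<lambda>i j. A $$ (i, j)) \<alpha> \<beta>) (at 0)"
    unfolding minor_deriv_def k
    by (rule derivative_eq_intros has_field_derivative_prod refl | simp)+ (simp add: mult.commute)
  then show ?thesis
    using A pq by (simp add: add_compound_def Let_def eq DERIV_imp_deriv flip: \<alpha>_def \<beta>_def)
qed

text \<open>Only the identity permutation contributes: any other one moves a position different from
  \<open>a\<close>, and the factor there is 0 because the entries of \<alpha> are distinct.\<close>

lemma minor_deriv_diag:
  assumes "distinct \<alpha>"
  shows "minor_deriv F \<alpha> \<alpha> = (\<Sum>i\<in>set \<alpha>. F i i)"
proof -
  define k where "k = length \<alpha>"
  let ?t = "\<lambda>p a. F (\<alpha> ! a) (\<alpha> ! p a) * (\<Prod>b\<in>{0..<k} - {a}. of_bool (\<alpha> ! b = \<alpha> ! p b))"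
  have zero: "?t p a = 0" if p: "p permutes {0..<k}" "p \<noteq> id" and a: "a < k" for p a
  proof -
    \<comment> \<open>A permutation cannot move exactly one point: if all points but
      \<open>a\<close> are fixed, injectivity fixes \<open>a\<close> as well.\<close>
    have "\<exists>b\<in>{0..<k} - {a}. p b \<noteq> b"
    proof (rule ccontr)
      assume "\<not> ?thesis"
      then have fixed: "p b = b" if "b \<noteq> a" for b
        using p(1) that by (cases "b < k") (auto simp: permutes_def)
      then have "p a = a"
        using p(1) by (metis permutes_inj injD)
      then show False
        using fixed p(2) by (auto simp: fun_eq_iff) metis
    qed
    then obtain b where "b \<in> {0..<k} - {a}" "p b \<noteq> b"
      by blast
    then have "b \<in> {0..<k} - {a}" "\<alpha> ! b \<noteq> \<alpha> ! p b"
      using assms permutes_nat_less[OF p(1)] by (auto simp: k_def nth_eq_iff_index_eq)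
    then have "(\<Prod>b\<in>{0..<k} - {a}. of_bool (\<alpha> ! b = \<alpha> ! p b)) = (0 :: real)"
      by (subst prod_zero_iff) auto
    then show ?thesis
      by simp
  qed
  have "minor_deriv F \<alpha> \<alpha> =
    (\<Sum>p | p permutes {0..<k}. if p = id then \<Sum>a\<in>{0..<k}. F (\<alpha> ! a) (\<alpha> ! a) else 0)"
    unfolding minor_deriv_def k_def[symmetric]
    by (intro sum.cong) (auto simp: zero sign_id)
  also have "\<dots> = (\<Sum>a\<in>{0..<k}. F (\<alpha> ! a) (\<alpha> ! a))"
    by (subst sum.delta) (auto simp: finite_permutations permutes_id)
  also have "\<dots> = (\<Sum>i\<in>set \<alpha>. F i i)"
    using assms unfolding k_def
    by (intro sum.reindex_bij_betw bij_betw_nth) (auto simp: atLeast0LessThan)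
  finally show ?thesis .
qed

text \<open>
  A nonzero term of an off-diagonal entry belongs to a triple \<open>(\<beta>, p, a)\<close> such that \<open>\<beta>\<close> arises
  from \<open>\<alpha>\<close> by exchanging \<open>i = \<alpha> ! a\<close> for some \<open>j \<notin> \<alpha>\<close>, and the pair \<open>(i, j)\<close> determines the triple.
\<close>

lemma minor_deriv_off_diag_sum_le:
  assumes \<alpha>: "\<alpha> \<in> set (incr_seqs n k)"
  shows "(\<Sum>\<beta>\<in>set (incr_seqs n k) - {\<alpha>}. \<bar>minor_deriv F \<alpha> \<beta>\<bar>)
    \<le> (\<Sum>i\<in>set \<alpha>. \<Sum>j\<in>{..<n} - set \<alpha>. \<bar>F i j\<bar>)"
proof -
  define P where "P = {p. p permutes {0..<k}}"
  define S where "S = set (incr_seqs n k) - {\<alpha>}"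
  \<comment> \<open>\<open>Q\<close> says that the product of the remaining identity entries is 1
    and not 0; \<open>f\<close> below records the exchanged pair (i, j).\<close>
  define Q where "Q = (\<lambda>(\<beta>, p, a). \<forall>b\<in>{0..<k} - {a}. \<alpha> ! b = \<beta> ! p b)"
  define T where "T = {t \<in> S \<times> P \<times> {0..<k}. Q t}"
  define f where "f = (\<lambda>(\<beta>, p, a :: nat). (\<alpha> ! a, \<beta> ! p a :: nat))"
  have fin: "finite S" "finite P"
    by (auto simp: S_def P_def finite_permutations)
  have k: "length \<alpha> = k" and dist: "distinct \<alpha>"
    using incr_seqsD[OF \<alpha>] by auto
  have TD: "\<beta> \<in> set (incr_seqs n k)" "\<beta> \<noteq> \<alpha>" "p permutes {0..<k}" "a < k"
    "\<And>b. b < k \<Longrightarrow> b \<noteq> a \<Longrightarrow> \<alpha> ! b = \<beta> ! p b"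
    if "(\<beta>, p, a) \<in> T" for \<beta> p a
    using that by (auto simp: T_def S_def P_def Q_def)
  have "\<bar>minor_deriv F \<alpha> \<beta>\<bar> \<le> (\<Sum>p\<in>P. \<Sum>a\<in>{0..<k}. if Q (\<beta>, p, a) then \<bar>F (\<alpha> ! a) (\<beta> ! p a)\<bar> else 0)"
    for \<beta>
  proof -
    \<comment> \<open>Triangle inequality for both sums, with signs of absolute value 1.\<close>
    have "\<bar>minor_deriv F \<alpha> \<beta>\<bar> \<le> (\<Sum>p\<in>P. \<Sum>a\<in>{0..<k}.
      \<bar>F (\<alpha> ! a) (\<beta> ! p a) * (\<Prod>b\<in>{0..<k} - {a}. of_bool (\<alpha> ! b = \<beta> ! p b))\<bar>)"
      unfolding minor_deriv_def k P_def
      by (rule order.trans[OF sum_abs], rule sum_mono)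
        (simp only: abs_mult[of "of_int _"] flip: of_int_abs, simp add: sign_def sum_abs)
    also have "\<dots> = (\<Sum>p\<in>P. \<Sum>a\<in>{0..<k}. if Q (\<beta>, p, a) then \<bar>F (\<alpha> ! a) (\<beta> ! p a)\<bar> else 0)"
      by (intro sum.cong) (auto simp: Q_def prod_zero_iff)
    finally show ?thesis .
  qed
  then have "(\<Sum>\<beta>\<in>S. \<bar>minor_deriv F \<alpha> \<beta>\<bar>)
    \<le> (\<Sum>\<beta>\<in>S. \<Sum>p\<in>P. \<Sum>a\<in>{0..<k}. if Q (\<beta>, p, a) then \<bar>F (\<alpha> ! a) (\<beta> ! p a)\<bar> else 0)"
    by (rule sum_mono)
  also have "\<dots> = (\<Sum>t\<in>S \<times> P \<times> {0..<k}. if Q t then \<bar>case_prod F (f t)\<bar> else 0)"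
    by (simp add: sum.cartesian_product f_def case_prod_unfold cong: if_cong)
  also have "\<dots> = (\<Sum>t\<in>T. \<bar>case_prod F (f t)\<bar>)"
    unfolding T_def using fin by (subst sum.inter_filter) auto
  also have "\<dots> = (\<Sum>x\<in>f ` T. \<bar>case_prod F x\<bar>)"
  proof (subst sum.reindex)
    show "inj_on f T"
    proof (rule inj_onI)
      fix t t'
      assume "t \<in> T" "t' \<in> T" and ft: "f t = f t'"
      obtain \<beta> p a where t: "t = (\<beta>, p, a)"
        by (rule prod_cases3)
      obtain \<beta>' p' a' where t': "t' = (\<beta>', p', a')"
        by (rule prod_cases3)
      note D = TD[OF \<open>t \<in> T\<close>[unfolded t]] and D' = TD[OF \<open>t' \<in> T\<close>[unfolded t']]
      note eq = ft[unfolded t t']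
      have a: "a' = a"
        using eq dist D(4) D'(4) k by (simp add: f_def nth_eq_iff_index_eq)
      \<comment> \<open>At position \<open>a\<close> this is the second component of
        \<open>f t = f t'\<close>; elsewhere both sides equal \<open>\<alpha> ! b\<close>. Equality
        of the sets, then of the sequences, then of the permutations follows.\<close>
      have nth: "\<beta> ! p b = \<beta>' ! p' b" if "b < k" for b
        using that D(5)[of b] D'(5)[of b] eq a by (cases "b = a") (auto simp: f_def)
      have "set \<beta> = set \<beta>'"
        using nth set_eq_image_permutes[OF incr_seqsD(1)[OF D(1)] D(3)]
          set_eq_image_permutes[OF incr_seqsD(1)[OF D'(1)] D'(3)] by auto
      then have \<beta>: "\<beta> = \<beta>'"
        using D(1) D'(1) by (rule incr_seqs_eqI[rotated 2])
      have "p b = p' b" for b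
      proof (cases "b < k")
        case True
        then show ?thesis
          using nth[OF True] incr_seqsD(1,3)[OF D'(1)] permutes_nat_less[OF D(3)] permutes_nat_less[OF D'(3)]
          by (simp add: \<beta> nth_eq_iff_index_eq)
      next
        case False
        then show ?thesis
          using D(3) D'(3) by (simp add: permutes_def)
      qed
      then show "t = t'"
        using \<beta> a by (auto simp: t t')
    qed
  qed simp
  also have "\<dots> \<le> (\<Sum>x\<in>set \<alpha> \<times> ({..<n} - set \<alpha>). \<bar>case_prod F x\<bar>)"
  proof (rule sum_mono2)
    show "f ` T \<subseteq> set \<alpha> \<times> ({..<n} - set \<alpha>)"
    proof (rule image_subsetI)
      fix t
      assume "t \<in> T"
      then obtain \<beta> p a where t: "t = (\<beta>, p, a)" and "(\<beta>, p, a) \<in> T"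
        by (cases t) auto
      note D = TD[OF this(2)]
      have "\<alpha> ! a \<in> set \<alpha>"
        using D(4) k by simp
      moreover have "\<beta> ! p a < n"
        using incr_seqs_nth_less[OF D(1)] permutes_nat_less[OF D(3)] D(4) by blast
      \<comment> \<open>If the new index were \<open>\<alpha> ! c\<close>, then c = a would make
        \<alpha> a rearrangement of \<beta> and so equal to it, while any other c would make \<beta>
        repeat an entry.\<close>
      moreover have "\<beta> ! p a \<notin> set \<alpha>"
      proof
        assume "\<beta> ! p a \<in> set \<alpha>"
        then obtain c where c: "c < k" "\<beta> ! p a = \<alpha> ! c"
          using k by (auto simp: in_set_conv_nth)
        show False
        proof (cases "c = a")
          case True
          then have "\<alpha> = \<beta>"
            using c D(5) by (intro incr_seqs_eq_if_permuted[OF \<alpha> D(1,3)]) metis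
          then show False
            using D(2) by simp
        next
          case False
          then have "\<beta> ! p a = \<beta> ! p c"
            using c D(5) by simp
          then have "p a = p c"
            using incr_seqsD(1,3)[OF D(1)] permutes_nat_less[OF D(3)] c(1) D(4)
            by (simp add: nth_eq_iff_index_eq)
          then show False
            using False D(3) by (metis permutes_inj injD)
        qed
      qed
      ultimately show "f t \<in> set \<alpha> \<times> ({..<n} - set \<alpha>)"
        by (simp add: t f_def)
    qed
  qed auto
  also have "\<dots> = (\<Sum>i\<in>set \<alpha>. \<Sum>j\<in>{..<n} - set \<alpha>. \<bar>F i j\<bar>)"
    by (simp add: sum.cartesian_product case_prod_unfold)
  finally show ?thesis
    unfolding S_def .
qed

text \<open>For D = diag(d), this is the identity D^(k) A^[k] (D^(k))^(-1) = (D A D^(-1))^[k], read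
  entrywise. In a nonzero term \<alpha> and the permuted \<beta> agree except at \<open>a\<close>,
  so the quotient of the two products collapses to a single ratio.\<close>

lemma minor_deriv_scale:
  assumes \<alpha>: "\<alpha> \<in> set (incr_seqs n k)" and \<beta>: "\<beta> \<in> set (incr_seqs n k)"
    and d: "\<And>i. i < n \<Longrightarrow> d i \<noteq> 0"
  shows "(\<Prod>a\<in>{0..<k}. d (\<alpha> ! a)) * minor_deriv F \<alpha> \<beta> * inverse (\<Prod>a\<in>{0..<k}. d (\<beta> ! a)) =
    minor_deriv (\<lambda>i j. d i / d j * F i j) \<alpha> \<beta>"
proof -
  have k: "length \<alpha> = k"
    using incr_seqsD[OF \<alpha>] by auto
  let ?h = "\<lambda>\<gamma>. \<Prod>a\<in>{0..<k}. d (\<gamma> ! a)"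
  have scaled: "?h \<alpha> * inverse (?h \<beta>) *
      (F (\<alpha> ! a) (\<beta> ! p a) * (\<Prod>b\<in>{0..<k} - {a}. of_bool (\<alpha> ! b = \<beta> ! p b))) =
    d (\<alpha> ! a) / d (\<beta> ! p a) * F (\<alpha> ! a) (\<beta> ! p a) *
      (\<Prod>b\<in>{0..<k} - {a}. of_bool (\<alpha> ! b = \<beta> ! p b))"
    if p: "p permutes {0..<k}" and a: "a < k" for p a
  proof (cases "\<forall>b\<in>{0..<k} - {a}. \<alpha> ! b = \<beta> ! p b")
    case True
    let ?g = "\<Prod>b\<in>{0..<k} - {a}. d (\<alpha> ! b)"
    \<comment> \<open>Reordering the factors by \<open>p\<close> aligns them with those of
      \<open>?h \<alpha>\<close>.\<close>
    have "?h \<beta> = (\<Prod>b\<in>{0..<k}. d (\<beta> ! p b))"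
      using prod.permute[OF p, of "\<lambda>b. d (\<beta> ! b)"] by (simp add: o_def)
    also have "\<dots> = d (\<beta> ! p a) * (\<Prod>b\<in>{0..<k} - {a}. d (\<beta> ! p b))"
      using a by (intro prod.remove) auto
    also have "(\<Prod>b\<in>{0..<k} - {a}. d (\<beta> ! p b)) = ?g"
      using True by (intro prod.cong) auto
    finally have "?h \<beta> = d (\<beta> ! p a) * ?g" .
    moreover have "?h \<alpha> = d (\<alpha> ! a) * ?g"
      using a by (intro prod.remove) auto
    moreover have "?g \<noteq> 0"
      using d incr_seqs_nth_less[OF \<alpha>] by (auto simp: prod_zero_iff)
    ultimately have "?h \<alpha> * inverse (?h \<beta>) = d (\<alpha> ! a) / d (\<beta> ! p a)"
      by (simp flip: divide_inverse)
    then show ?thesis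
      by (simp only: mult.assoc[symmetric])
  next
    case False
    then have "(\<Prod>b\<in>{0..<k} - {a}. of_bool (\<alpha> ! b = \<beta> ! p b)) = (0 :: real)"
      by (subst prod_zero_iff) auto
    then show ?thesis
      by (simp only: mult_zero_right)
  qed
  have "?h \<alpha> * inverse (?h \<beta>) * minor_deriv F \<alpha> \<beta> =
    (\<Sum>p | p permutes {0..<k}. of_int (sign p) * (\<Sum>a\<in>{0..<k}. ?h \<alpha> * inverse (?h \<beta>) *
      (F (\<alpha> ! a) (\<beta> ! p a) * (\<Prod>b\<in>{0..<k} - {a}. of_bool (\<alpha> ! b = \<beta> ! p b)))))"
    unfolding minor_deriv_def k
    by (simp only: sum_distrib_left[of "?h \<alpha> * inverse (?h \<beta>)", symmetric]
        mult.left_commute[of "of_int _"])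
  also have "\<dots> = minor_deriv (\<lambda>i j. d i / d j * F i j) \<alpha> \<beta>"
    unfolding minor_deriv_def k
    by (rule sum.cong[OF refl], rule arg_cong2[where f = "(*)", OF refl], rule sum.cong[OF refl],
        rule scaled) simp_all
  finally show ?thesis
    by (simp only: mult.assoc mult.commute[of "minor_deriv _ _ _"])
qed

text \<open>The submatrix of a diagonal minor is itself diagonal. For distinct row and column
  sequences each Leibniz term has a position where the indices differ, and thus a zero
  factor.\<close>

lemma mult_compound_mat_diag:
  "mult_compound k (mat_diag n d) =
    mat_diag (n choose k) (\<lambda>p. \<Prod>a\<in>{0..<k}. d (incr_seqs n k ! p ! a))"
proof (rule eq_matI)
  fix p q
  assume "p < dim_row (mat_diag (n choose k) (\<lambda>p. \<Prod>a\<in>{0..<k}. d (incr_seqs n k ! p ! a)))"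
    and "q < dim_col (mat_diag (n choose k) (\<lambda>p. \<Prod>a\<in>{0..<k}. d (incr_seqs n k ! p ! a)))"
  then have pq: "p < n choose k" "q < n choose k"
    by (auto simp: mat_diag_def)
  define \<alpha> \<beta> where "\<alpha> = incr_seqs n k ! p" and "\<beta> = incr_seqs n k ! q"
  have \<alpha>: "\<alpha> \<in> set (incr_seqs n k)" and \<beta>: "\<beta> \<in> set (incr_seqs n k)"
    using pq by (auto simp: \<alpha>_def \<beta>_def length_incr_seqs)
  let ?B = "mat k k (\<lambda>(a, b). mat_diag n d $$ (\<alpha> ! a, \<beta> ! b))"
  have B: "?B $$ (a, b) = (if \<alpha> ! a = \<beta> ! b then d (\<beta> ! b) else 0)" if "a < k" "b < k" for a b
    using that by (simp add: mat_diag_def incr_seqs_nth_less[OF \<alpha>] incr_seqs_nth_less[OF \<beta>])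
  have "det ?B = (if p = q then \<Prod>a\<in>{0..<k}. d (\<alpha> ! a) else 0)"
  proof (cases "p = q")
    case True
    then have "\<beta> = \<alpha>"
      by (simp add: \<alpha>_def \<beta>_def)
    then have "?B $$ (a, b) = (if a = b then d (\<alpha> ! a) else 0)" if "a < k" "b < k" for a b
      using B[OF that] that incr_seqsD[OF \<alpha>] by (auto simp: nth_eq_iff_index_eq)
    then have "det ?B = (\<Prod>a\<in>{0..<k}. ?B $$ (a, a))"
      by (subst det_upper_triangular[of _ k]) (auto simp: prod_list_diag_prod simp del: index_mat)
    then show ?thesis
      using True B \<open>\<beta> = \<alpha>\<close> by (auto simp del: index_mat intro!: prod.cong)
  next
    case False
    then have "\<alpha> \<noteq> \<beta>"
      using distinct_incr_seqs[of n k] pq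
      by (simp add: \<alpha>_def \<beta>_def nth_eq_iff_index_eq length_incr_seqs)
    have "(\<Prod>a\<in>{0..<k}. ?B $$ (a, \<pi> a)) = 0" if \<pi>: "\<pi> permutes {0..<k}" for \<pi>
    proof -
      obtain a where "a < k" "\<alpha> ! a \<noteq> \<beta> ! \<pi> a"
        using incr_seqs_eq_if_permuted[OF \<alpha> \<beta> \<pi>] \<open>\<alpha> \<noteq> \<beta>\<close> by blast
      then show ?thesis
        using B[of a "\<pi> a"] permutes_nat_less[OF \<pi>, of a] by (intro prod_zero) force+
    qed
    then show ?thesis
      using False by (subst det_def'[of _ k]) (auto simp del: index_mat intro!: sum.neutral)
  qed
  then show "mult_compound k (mat_diag n d) $$ (p, q) =
    mat_diag (n choose k) (\<lambda>p. \<Prod>a\<in>{0..<k}. d (incr_seqs n k ! p ! a)) $$ (p, q)"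
    using pq by (auto simp: mult_compound_def Let_def mat_diag_def \<alpha>_def \<beta>_def)
qed (auto simp: mult_compound_def Let_def mat_diag_def)

text \<open>\<open>mat_inverse\<close> is given by an elimination procedure, so its value is
  identified through uniqueness: the returned left inverse must equal the explicit right inverse
  \<open>?K\<close>.\<close>

lemma mat_inverse_mat_diag:
  fixes h :: "nat \<Rightarrow> 'a :: field"
  assumes "\<And>i. i < n \<Longrightarrow> h i \<noteq> 0"
  shows "mat_inverse (mat_diag n h) = Some (mat_diag n (\<lambda>i. inverse (h i)))"
proof -
  let ?H = "mat_diag n h" and ?K = "mat_diag n (\<lambda>i. inverse (h i))"
  have HK: "?H * ?K = 1\<^sub>m n" and KH: "?K * ?H = 1\<^sub>m n"
    using assms by (simp_all, auto simp: mat_diag_def intro!: eq_matI)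
  then have "?H \<in> Units (ring_mat TYPE('a) n ())"
    by (auto simp: Units_def ring_mat_def intro!: bexI[of _ ?K])
  then obtain B where B: "mat_inverse ?H = Some B"
    using mat_inverse(1)[of ?H n "()"] by (cases "mat_inverse ?H") auto
  then have BH: "B * ?H = 1\<^sub>m n" and carrier: "B \<in> carrier_mat n n"
    using mat_inverse(2)[of ?H n] by auto
  have "B = B * (?H * ?K)"
    unfolding HK using carrier by simp
  also have "\<dots> = B * ?H * ?K"
    using carrier by (intro assoc_mult_mat[symmetric, of _ n n _ n _ n]) auto
  also have "\<dots> = ?K"
    unfolding BH by (rule left_mult_one_mat) (rule mat_diag_dim)
  finally show ?thesis
    using B by simp
qed

text \<open>Reduces the scaled log norm to one inequality per k-subset \<open>S\<close>, namely the
  row of the scaled compound indexed by \<open>S\<close>. The assumption \<open>k \<le> n\<close>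
  makes the compound nonempty, so that the maximum over rows is meaningful.\<close>

lemma log_norm_compound_le:
  assumes A: "A \<in> carrier_mat n n" and k: "k \<le> n"
    and d: "\<And>i. i < n \<Longrightarrow> 0 < d i"
    and le: "\<And>S. S \<subseteq> {..<n} \<Longrightarrow> card S = k \<Longrightarrow>
      (\<Sum>i\<in>S. A $$ (i, i)) + (\<Sum>i\<in>S. \<Sum>j\<in>{..<n} - S. d i / d j * \<bar>A $$ (i, j)\<bar>) \<le> c"
  shows "log_norm_Linf_scaled (mult_compound k (mat_diag n d)) (add_compound k A) \<le> c"
proof -
  define N where "N = n choose k"
  define s where "s = incr_seqs n k"
  define h where "h = (\<lambda>p. \<Prod>a\<in>{0..<k}. d (s ! p ! a))"
  \<comment> \<open>\<open>F\<close> holds the entries of D A D^(-1) with D = diag(d), and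
    \<open>C\<close> is its additive compound.\<close>
  define F where "F = (\<lambda>i j. d i / d j * A $$ (i, j))"
  define C where "C = mat N N (\<lambda>(p, q). minor_deriv F (s ! p) (s ! q))"
  have s: "s ! p \<in> set s" if "p < N" for p
    using that by (simp add: s_def N_def length_incr_seqs)
  have h: "h p \<noteq> 0" if "p < N" for p
    using s[OF that] incr_seqs_nth_less[of "s ! p" n k] d unfolding h_def s_def
    by (force simp: prod_zero_iff)
  have AC: "add_compound k A \<in> carrier_mat N N"
    using A by (simp add: add_compound_carrier N_def)
  have "mult_compound k (mat_diag n d) * add_compound k A
      * the (mat_inverse (mult_compound k (mat_diag n d))) =
    mat_diag N h * add_compound k A * mat_diag N (\<lambda>p. inverse (h p))"
    using mat_inverse_mat_diag[of N h, OF h]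
    by (simp add: mult_compound_mat_diag h_def s_def N_def)
  also have "\<dots> = mat N N (\<lambda>(p, q). h p * add_compound k A $$ (p, q) * inverse (h q))"
    by (subst mat_diag_mult_left[OF AC], subst mat_diag_mult_right[of _ N]) auto
  also have "\<dots> = C"
    unfolding C_def
  proof (intro cong_mat refl, clarsimp)
    fix p q
    assume pq: "p < N" "q < N"
    then show "h p * add_compound k A $$ (p, q) * inverse (h q) = minor_deriv F (s ! p) (s ! q)"
      unfolding F_def h_def using s[of p] s[of q] d[THEN less_imp_neq]
      by (subst minor_deriv_scale[symmetric, of _ n k])
        (auto simp: add_compound_index[OF A] N_def s_def)
  qed
  finally have "log_norm_Linf_scaled (mult_compound k (mat_diag n d)) (add_compound k A) =
    log_norm Linf_norm C"
    by (simp add: log_norm_Linf_scaled_def)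
  also have "\<dots> = Max ((\<lambda>p. C $$ (p, p) + (\<Sum>q\<in>{..<N} - {p}. \<bar>C $$ (p, q)\<bar>)) ` {..<N})"
    using k by (intro log_norm_Linf) (auto simp: C_def N_def)
  also have "\<dots> \<le> c"
  proof (rule Max.boundedI)
    show "(\<lambda>p. C $$ (p, p) + (\<Sum>q\<in>{..<N} - {p}. \<bar>C $$ (p, q)\<bar>)) ` {..<N} \<noteq> {}"
      using k by (auto simp: N_def lessThan_empty_iff)
    fix y
    assume "y \<in> (\<lambda>p. C $$ (p, p) + (\<Sum>q\<in>{..<N} - {p}. \<bar>C $$ (p, q)\<bar>)) ` {..<N}"
    then obtain p where p: "p < N" and y: "y = C $$ (p, p) + (\<Sum>q\<in>{..<N} - {p}. \<bar>C $$ (p, q)\<bar>)"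
      by auto
    note \<alpha> = s[OF p, unfolded s_def]
    \<comment> \<open>The enumeration has no repetitions, so the columns other than \<open>p\<close>
      are exactly the sequences other than \<open>s ! p\<close>.\<close>
    have bij: "bij_betw (\<lambda>q. s ! q) ({..<N} - {p}) (set s - {s ! p})"
    proof (rule bij_betw_DiffI)
      show "bij_betw (\<lambda>q. s ! q) {..<N} (set s)"
        unfolding s_def N_def using distinct_incr_seqs
        by (intro bij_betw_nth) (auto simp: length_incr_seqs)
    qed (use p s in auto)
    have S: "set (s ! p) \<subseteq> {..<n}" "card (set (s ! p)) = k" "distinct (s ! p)"
      using incr_seqsD[OF \<alpha>] by (auto simp: s_def distinct_card)
    have "(\<Sum>q\<in>{..<N} - {p}. \<bar>C $$ (p, q)\<bar>) = (\<Sum>q\<in>{..<N} - {p}. \<bar>minor_deriv F (s ! p) (s ! q)\<bar>)"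
      using p by (intro sum.cong) (auto simp: C_def)
    also have "\<dots> = (\<Sum>\<beta>\<in>set s - {s ! p}. \<bar>minor_deriv F (s ! p) \<beta>\<bar>)"
      by (rule sum.reindex_bij_betw[OF bij])
    also have "\<dots> \<le> (\<Sum>i\<in>set (s ! p). \<Sum>j\<in>{..<n} - set (s ! p). \<bar>F i j\<bar>)"
      using minor_deriv_off_diag_sum_le[OF \<alpha>] by (simp add: s_def)
    also have "\<dots> = (\<Sum>i\<in>set (s ! p). \<Sum>j\<in>{..<n} - set (s ! p). d i / d j * \<bar>A $$ (i, j)\<bar>)"
    proof (intro sum.cong refl)
      fix i j
      assume "i \<in> set (s ! p)" "j \<in> {..<n} - set (s ! p)"
      then have "0 < d i" "0 < d j"
        using S(1) d by auto
      then show "\<bar>F i j\<bar> = d i / d j * \<bar>A $$ (i, j)\<bar>"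
        by (simp add: F_def abs_mult)
    qed
    finally have off: "(\<Sum>q\<in>{..<N} - {p}. \<bar>C $$ (p, q)\<bar>)
      \<le> (\<Sum>i\<in>set (s ! p). \<Sum>j\<in>{..<n} - set (s ! p). d i / d j * \<bar>A $$ (i, j)\<bar>)" .
    have "C $$ (p, p) = (\<Sum>i\<in>set (s ! p). F i i)"
      using p S(3) by (simp add: C_def minor_deriv_diag)
    also have "\<dots> = (\<Sum>i\<in>set (s ! p). A $$ (i, i))"
      using S(1) d by (intro sum.cong) (force simp: F_def)+
    finally show "y \<le> c"
      using y off le[OF S(1,2)] by linarith
  qed simp
  finally show ?thesis .
qed

section \<open>Hopfield networks\<close>

lemma hopfield_jacobian_index:
  assumes "W \<in> carrier_mat n n" and "i < n" and "j < n"
  shows "hopfield_jacobian n r W \<phi> x $$ (i, j) =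
    - (if i = j then inverse (r j) else 0) + W $$ (i, j) * deriv (\<phi> j) (x $ j)"
  unfolding hopfield_jacobian_def using assms
  by (subst mat_diag_mult_right[of _ n n]) (auto simp: mat_diag_def)

lemma hopfield_jacobian_carrier:
  assumes "W \<in> carrier_mat n n"
  shows "hopfield_jacobian n r W \<phi> x \<in> carrier_mat n n"
  using assms by (simp add: hopfield_jacobian_def mat_diag_def)

lemma has_jacobian_hopfield:
  fixes x :: "real vec"
  assumes W: "W \<in> carrier_mat n n" and x: "x \<in> carrier_vec n"
    and \<phi>: "\<And>i. i < n \<Longrightarrow> (\<phi> i has_real_derivative deriv (\<phi> i) (x $ i)) (at (x $ i))"
  shows "has_jacobian n (hopfield_field n r W \<phi> u) x (hopfield_jacobian n r W \<phi> x)"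
  unfolding has_jacobian_def
proof (intro conjI allI impI hopfield_jacobian_carrier[OF W])
  fix i j
  assume i: "i < n" and j: "j < n"
  \<comment> \<open>Along the j-th unit direction coordinate l becomes
    \<open>x $ l + t * ?\<delta> l\<close>, which covers l = j and the constant coordinates by one
    formula.\<close>
  let ?\<delta> = "\<lambda>l. of_bool (l = j) :: real"
  have comp: "((\<lambda>t. \<phi> l (x $ l + t * ?\<delta> l)) has_real_derivative deriv (\<phi> l) (x $ l) * ?\<delta> l) (at 0)"
    if "l < n" for l
    by (rule DERIV_chain2[where f = "\<phi> l"]) (use \<phi>[OF that] in \<open>auto intro!: derivative_eq_intros\<close>)
  have "((\<lambda>t. - (x $ i + t * ?\<delta> i) / r i + (\<Sum>l<n. W $$ (i, l) * \<phi> l (x $ l + t * ?\<delta> l)) + u i)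
    has_real_derivative
      - ?\<delta> i / r i + (\<Sum>l<n. W $$ (i, l) * (deriv (\<phi> l) (x $ l) * ?\<delta> l)) + 0) (at 0)"
    by (intro DERIV_add DERIV_sum DERIV_cmult comp DERIV_const DERIV_cdivide DERIV_minus)
      (auto intro!: derivative_eq_intros)
  moreover have "- ?\<delta> i / r i + (\<Sum>l<n. W $$ (i, l) * (deriv (\<phi> l) (x $ l) * ?\<delta> l)) + 0 =
    hopfield_jacobian n r W \<phi> x $$ (i, j)"
    using j by (simp add: hopfield_jacobian_index[OF W i j] of_bool_def if_distrib divide_inverse
        sum.delta cong: if_cong)
  moreover have "(\<lambda>t. - (x $ i + t * ?\<delta> i) / r i + (\<Sum>l<n. W $$ (i, l) * \<phi> l (x $ l + t * ?\<delta> l)) + u i) =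
    (\<lambda>t. hopfield_field n r W \<phi> u (x + t \<cdot>\<^sub>v unit_vec n j) $ i)"
    using i j x by (auto simp: hopfield_field_def unit_vec_def of_bool_def fun_eq_iff
        diff_divide_distrib add_divide_distrib intro!: sum.cong arg_cong2[where f = "(+)"])
  ultimately show "((\<lambda>t. hopfield_field n r W \<phi> u (x + t \<cdot>\<^sub>v unit_vec n j) $ i)
    has_real_derivative hopfield_jacobian n r W \<phi> x $$ (i, j)) (at 0)"
    by simp
qed

lemma complement_average_bound:
  fixes c e d :: "nat \<Rightarrow> real" and g :: "nat \<Rightarrow> nat \<Rightarrow> real"
  assumes S: "S \<subseteq> {..<n}" "card S = k" and k: "k < n"
    and ce: "\<And>i. i < n \<Longrightarrow> 0 \<le> c i + e i"
    and g: "\<And>i j. i < n \<Longrightarrow> j < n \<Longrightarrow> 0 \<le> g i j"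
    and le: "\<And>i. i < n \<Longrightarrow> (real n - real k - 1) * e i
      + (\<Sum>j\<in>{..<n} - {i}. c j + (real n - real k) * g i j) \<le> b"
  shows "(\<Sum>i\<in>S. c i) + (\<Sum>i\<in>S. \<Sum>j\<in>{..<n} - S. g j i) \<le> b"
proof -
  define T where "T = {..<n} - S"
  define K where "K = real n - real k"
  have fin: "finite S" "finite T"
    using S(1) by (auto simp: T_def finite_subset)
  have cardT: "real (card T) = K"
    using S k by (simp add: T_def K_def card_Diff_subset fin of_nat_diff)
  have K: "0 < K" "0 \<le> K - 1"
    using k by (auto simp: K_def)
  have bound: "(K - 1) * e i + ((\<Sum>j\<in>S. c j) + (\<Sum>j\<in>T. c j) - c i) + K * (\<Sum>j\<in>S. g i j) \<le> b"
    if i: "i \<in> T" for i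
  proof -
    have i': "i < n" "i \<notin> S"
      using i by (auto simp: T_def)
    have "(\<Sum>j<n. c j) = (\<Sum>j\<in>S. c j) + (\<Sum>j\<in>T. c j)"
      unfolding T_def using S(1) by (subst sum.subset_diff[of S]) auto
    moreover have "(\<Sum>j<n. c j) = c i + (\<Sum>j\<in>{..<n} - {i}. c j)"
      using i' by (intro sum.remove) auto
    \<comment> \<open>Since \<open>i\<close> lies outside \<open>S\<close>, the sum over
      \<open>S\<close> is part of the sum over j other than i; the remaining terms are
      nonnegative.\<close>
    moreover have "(\<Sum>j\<in>S. g i j) \<le> (\<Sum>j\<in>{..<n} - {i}. g i j)"
      using S(1) i' g by (intro sum_mono2) auto
    then have "K * (\<Sum>j\<in>S. g i j) \<le> K * (\<Sum>j\<in>{..<n} - {i}. g i j)"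
      using K by (intro mult_left_mono) auto
    ultimately show ?thesis
      using le[OF i'(1)] by (simp add: sum.distrib sum_distrib_left K_def)
  qed
  have "(\<Sum>i\<in>T. (K - 1) * e i + ((\<Sum>j\<in>S. c j) + (\<Sum>j\<in>T. c j) - c i) + K * (\<Sum>j\<in>S. g i j)) \<le> K * b"
    using sum_bounded_above[of T, OF bound] by (simp add: cardT)
  moreover have "(\<Sum>i\<in>T. (K - 1) * e i + ((\<Sum>j\<in>S. c j) + (\<Sum>j\<in>T. c j) - c i) + K * (\<Sum>j\<in>S. g i j)) =
    K * ((\<Sum>j\<in>S. c j) + (\<Sum>i\<in>T. \<Sum>j\<in>S. g i j)) + (K - 1) * (\<Sum>i\<in>T. c i + e i)"
    by (simp add: sum.distrib sum_subtractf cardT flip: sum_distrib_left) (simp add: algebra_simps)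
  moreover have "0 \<le> (K - 1) * (\<Sum>i\<in>T. c i + e i)"
    using K ce by (intro mult_nonneg_nonneg sum_nonneg) (auto simp: T_def)
  ultimately have "K * ((\<Sum>j\<in>S. c j) + (\<Sum>i\<in>T. \<Sum>j\<in>S. g i j)) \<le> K * b"
    by linarith
  then have "(\<Sum>j\<in>S. c j) + (\<Sum>i\<in>T. \<Sum>j\<in>S. g i j) \<le> b"
    using K by simp
  then show ?thesis
    unfolding T_def by (subst sum.swap)
qed

theorem proposition24:
  fixes n k :: nat
    and r u d m M :: "nat \<Rightarrow> real"
    and W :: "real mat"
    and \<phi> :: "nat \<Rightarrow> real \<Rightarrow> real"
    and \<eta> :: real
  assumes "2 \<le> n" and "1 \<le> k" and "k \<le> n - 1"
    and "W \<in> carrier_mat n n"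
    and "\<And>i. i < n \<Longrightarrow> 0 < r i"
    and "\<And>i. i < n \<Longrightarrow> \<phi> i C1_differentiable_on UNIV"
    and "\<And>i z. i < n \<Longrightarrow> 0 \<le> m i \<and> m i \<le> \<bar>deriv (\<phi> i) z\<bar> \<and> \<bar>deriv (\<phi> i) z\<bar> \<le> M i"
    and "\<And>i. i < n \<Longrightarrow> 0 < d i"
    and "0 < \<eta>"
    and "\<And>i. i < n \<Longrightarrow>
      - (real n - real k - 1) * (- inverse (r i) - m i * \<bar>W $$ (i, i)\<bar>)
      + (\<Sum>j \<in> {..<n} - {i}.
           - inverse (r j) + M j * \<bar>W $$ (j, j)\<bar>
           + (real n - real k) * (d j / d i) * M i * \<bar>W $$ (j, i)\<bar>) \<le> - \<eta>"
  shows "k_contractive_Linf n k (mat_diag n d) \<eta> (hopfield_field n r W \<phi> u) \<and>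
    (\<forall>x \<in> carrier_vec n.
       has_jacobian n (hopfield_field n r W \<phi> u) x (hopfield_jacobian n r W \<phi> x) \<and>
       log_norm_Linf_scaled (mult_compound k (mat_diag n d))
         (add_compound k (hopfield_jacobian n r W \<phi> x)) \<le> - \<eta>)"
proof -
  note W = \<open>W \<in> carrier_mat n n\<close>
  note C1 = assms(6) and mM = assms(7) and d = assms(8) and le = assms(10)
  have k: "k < n" "k \<le> n"
    using assms(1-3) by auto
  have M0: "0 \<le> m i" "0 \<le> M i" if "i < n" for i
    using mM[OF that, of 0] by linarith+
  have main: "has_jacobian n (hopfield_field n r W \<phi> u) x (hopfield_jacobian n r W \<phi> x)"
    "log_norm_Linf_scaled (mult_compound k (mat_diag n d))
      (add_compound k (hopfield_jacobian n r W \<phi> x)) \<le> - \<eta>"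
    if x: "x \<in> carrier_vec n" for x
  proof -
    show "has_jacobian n (hopfield_field n r W \<phi> u) x (hopfield_jacobian n r W \<phi> x)"
    proof (rule has_jacobian_hopfield[OF W x])
      fix i assume "i < n"
      then obtain D where "(\<phi> i has_real_derivative D) (at (x $ i))"
        using C1 by (auto simp: C1_differentiable_on_def simp flip: has_real_derivative_iff_has_vector_derivative)
      then show "(\<phi> i has_real_derivative deriv (\<phi> i) (x $ i)) (at (x $ i))"
        by (metis DERIV_imp_deriv)
    qed
    let ?J = "hopfield_jacobian n r W \<phi> x"
    \<comment> \<open>\<open>?c j\<close> bounds the diagonal entry \<open>?J $$ (j, j)\<close>,
      \<open>?e i\<close> is the negated bracket of the hypothesis, and \<open>?g i j\<close> bounds
      the scaled entry in row j and column i. The row index of the Jacobian is thus the second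
      argument of \<open>?g\<close>.\<close>
    let ?c = "\<lambda>j. - inverse (r j) + M j * \<bar>W $$ (j, j)\<bar>"
    let ?e = "\<lambda>i. inverse (r i) + m i * \<bar>W $$ (i, i)\<bar>"
    let ?g = "\<lambda>i j. d j / d i * M i * \<bar>W $$ (j, i)\<bar>"
    show "log_norm_Linf_scaled (mult_compound k (mat_diag n d)) (add_compound k ?J) \<le> - \<eta>"
    proof (rule log_norm_compound_le[OF hopfield_jacobian_carrier[OF W] k(2) d])
      fix S assume S: "S \<subseteq> {..<n}" "card S = k"
      have "(\<Sum>i\<in>S. ?J $$ (i, i)) \<le> (\<Sum>i\<in>S. ?c i)"
      proof (rule sum_mono)
        fix i assume "i \<in> S"
        then have i: "i < n"
          using S by auto
        have "W $$ (i, i) * deriv (\<phi> i) (x $ i) \<le> \<bar>deriv (\<phi> i) (x $ i)\<bar> * \<bar>W $$ (i, i)\<bar>"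
          by (metis abs_ge_self abs_mult mult.commute)
        also have "\<dots> \<le> M i * \<bar>W $$ (i, i)\<bar>"
          using mM[OF i] by (intro mult_right_mono) auto
        finally show "?J $$ (i, i) \<le> ?c i"
          by (simp add: hopfield_jacobian_index[OF W i i])
      qed
      moreover have "(\<Sum>i\<in>S. \<Sum>j\<in>{..<n} - S. d i / d j * \<bar>?J $$ (i, j)\<bar>)
        \<le> (\<Sum>i\<in>S. \<Sum>j\<in>{..<n} - S. ?g j i)"
      proof (intro sum_mono)
        fix i j assume "i \<in> S" "j \<in> {..<n} - S"
        then have ij: "i < n" "j < n" "i \<noteq> j"
          using S by auto
        \<comment> \<open>Off the diagonal the decay rates are absent, and the derivative of \<phi>
          belongs to the column index.\<close>
        have "\<bar>?J $$ (i, j)\<bar> \<le> M j * \<bar>W $$ (i, j)\<bar>"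
          using ij mM[of j] by (auto simp: hopfield_jacobian_index[OF W] abs_mult
              mult.commute[of "M j"] intro!: mult_left_mono)
        then have "d i / d j * \<bar>?J $$ (i, j)\<bar> \<le> d i / d j * (M j * \<bar>W $$ (i, j)\<bar>)"
          using ij d by (intro mult_left_mono) (auto simp: less_imp_le)
        then show "d i / d j * \<bar>?J $$ (i, j)\<bar> \<le> ?g j i"
          by (simp add: mult.assoc)
      qed
      moreover have "(\<Sum>i\<in>S. ?c i) + (\<Sum>i\<in>S. \<Sum>j\<in>{..<n} - S. ?g j i) \<le> - \<eta>"
      proof (rule complement_average_bound[OF S k(1), where e = ?e])
        fix i assume i: "i < n"
        show "0 \<le> ?c i + ?e i"
          using M0[OF i] by simp
        show "0 \<le> ?g i j" if "j < n" for j
          using M0[OF i] d[OF i] d[OF that] by simp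
        have "(real n - real k - 1) * ?e i
            = - (real n - real k - 1) * (- inverse (r i) - m i * \<bar>W $$ (i, i)\<bar>)"
          by (simp add: algebra_simps)
        then show "(real n - real k - 1) * ?e i
            + (\<Sum>j\<in>{..<n} - {i}. ?c j + (real n - real k) * ?g i j) \<le> - \<eta>"
          using le[OF i] by (simp add: mult.assoc)
      qed
      ultimately show "(\<Sum>i\<in>S. ?J $$ (i, i))
        + (\<Sum>i\<in>S. \<Sum>j\<in>{..<n} - S. d i / d j * \<bar>?J $$ (i, j)\<bar>) \<le> - \<eta>"
        by linarith
    qed
  qed
  then show ?thesis
    using \<open>0 < \<eta>\<close> unfolding k_contractive_Linf_def by blast
qed

end
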